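(* Let $E_1,\dots,E_k\subseteq\mathbb{F}_q^d$ be non-empty and let $p_1,\dots,p_k\ge1$ satisfy $\sum_{i=1}^k 1/p_i=1$. If, for each $i$, $E_i$ is $(2p_i,s_i)$-Salem, then \[ \#(E_1+\cdots+E_k)\gtrsim q^d\wedge(\#E_1)^{2s_1}\cdots(\#E_k)^{2s_k}, \] where $E_1+\cdots+E_k=\{x_1+\cdots+x_k:x_i\in E_i\}$.
   Context: $q$ is a prime power, $\chi$ a fixed non-trivial additive character of $\mathbb{F}_q$, $a\wedge b=\min\{a,b\}$. For $E\subseteq\mathbb{F}_q^d$, $\widehat E(x)=q^{-d}\sum_{y\in E}\chi(-x\cdot y)$; $\|\widehat E\|_p=\big(q^{-d}\sum_{x\ne0}|\widehat E(x)|^p\big)^{1/p}$. Sets are families indexed by $q$; $A\lesssim B$ means $A\le cB$ with $c$ independent of $q$, $A\gtrsim B$ means $B\lesssim A$. $E$ is $(p,s)$-Salem if $\|\widehat E\|_p\lesssim q^{-d}(\#E)^{1-s}$. *)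

theory Defs
  imports Complex_Main "HOL-Library.FuncSet" "HOL-Algebra.Ring" "HOL-Number_Theory.Prime_Powers"
begin

(* F q is a field with q elements for every prime power q; since such a field is unique up to
   isomorphism, F plays the role of the family of all finite fields.  Values of F at arguments
   that are not prime powers are irrelevant. *)
definition finite_field_family :: "(nat \<Rightarrow> ('a, 'm) ring_scheme) \<Rightarrow> bool" where
  "finite_field_family F \<longleftrightarrow>
     (\<forall>q. primepow q \<longrightarrow> field (F q) \<and> finite (carrier (F q)) \<and> card (carrier (F q)) = q)"

definition nontrivial_add_char :: "('a, 'm) ring_scheme \<Rightarrow> ('a \<Rightarrow> complex) \<Rightarrow> bool" where
  "nontrivial_add_char R \<chi> \<longleftrightarrow>
     (\<forall>a\<in>carrier R. cmod (\<chi> a) = 1) \<and>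
     (\<forall>a\<in>carrier R. \<forall>b\<in>carrier R. \<chi> (a \<oplus>\<^bsub>R\<^esub> b) = \<chi> a * \<chi> b) \<and>
     (\<exists>a\<in>carrier R. \<chi> a \<noteq> 1)"

(* Vectors with d coordinates are functions with domain {..<d}, extensional so that
   cardinalities of sets of vectors are the intended ones. *)
definition vecs :: "('a, 'm) ring_scheme \<Rightarrow> nat \<Rightarrow> (nat \<Rightarrow> 'a) set" where
  "vecs R d = {..<d} \<rightarrow>\<^sub>E carrier R"

definition zero_vec :: "('a, 'm) ring_scheme \<Rightarrow> nat \<Rightarrow> nat \<Rightarrow> 'a" where
  "zero_vec R d = (\<lambda>i\<in>{..<d}. \<zero>\<^bsub>R\<^esub>)"

definition dot :: "('a, 'm) ring_scheme \<Rightarrow> nat \<Rightarrow> (nat \<Rightarrow> 'a) \<Rightarrow> (nat \<Rightarrow> 'a) \<Rightarrow> 'a" where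
  "dot R d x y = (\<Oplus>\<^bsub>R\<^esub>i\<in>{..<d}. x i \<otimes>\<^bsub>R\<^esub> y i)"

definition sumset :: "('a, 'm) ring_scheme \<Rightarrow> nat \<Rightarrow> nat \<Rightarrow> (nat \<Rightarrow> (nat \<Rightarrow> 'a) set) \<Rightarrow> (nat \<Rightarrow> 'a) set" where
  "sumset R d k A = {(\<lambda>i\<in>{..<d}. \<Oplus>\<^bsub>R\<^esub>j\<in>{1..k}. x j i) | x. \<forall>j\<in>{1..k}. x j \<in> A j}"

definition fourier ::
  "('a, 'm) ring_scheme \<Rightarrow> ('a \<Rightarrow> complex) \<Rightarrow> nat \<Rightarrow> (nat \<Rightarrow> 'a) set \<Rightarrow> (nat \<Rightarrow> 'a) \<Rightarrow> complex" where
  "fourier R \<chi> d A x =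
     (\<Sum>y\<in>A. \<chi> (\<ominus>\<^bsub>R\<^esub> dot R d x y)) / of_nat (card (carrier R)) ^ d"

definition fourier_norm ::
  "('a, 'm) ring_scheme \<Rightarrow> ('a \<Rightarrow> complex) \<Rightarrow> nat \<Rightarrow> real \<Rightarrow> (nat \<Rightarrow> 'a) set \<Rightarrow> real" where
  "fourier_norm R \<chi> d p A =
     ((\<Sum>x \<in> vecs R d - {zero_vec R d}. cmod (fourier R \<chi> d A x) powr p)
        / real (card (carrier R)) ^ d) powr (1 / p)"

definition lesssim :: "(nat \<Rightarrow> real) \<Rightarrow> (nat \<Rightarrow> real) \<Rightarrow> bool"  (infix "\<lesssim>" 50) where
  "A \<lesssim> B \<longleftrightarrow> (\<exists>c>0. \<forall>q. primepow q \<longrightarrow> A q \<le> c * B q)"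

abbreviation gtrsim :: "(nat \<Rightarrow> real) \<Rightarrow> (nat \<Rightarrow> real) \<Rightarrow> bool"  (infix "\<greatersim>" 50) where
  "A \<greatersim> B \<equiv> B \<lesssim> A"

definition salem ::
  "(nat \<Rightarrow> ('a, 'm) ring_scheme) \<Rightarrow> (nat \<Rightarrow> 'a \<Rightarrow> complex) \<Rightarrow> nat \<Rightarrow> real \<Rightarrow> real \<Rightarrow>
     (nat \<Rightarrow> (nat \<Rightarrow> 'a) set) \<Rightarrow> bool" where
  "salem F \<chi> d p s E \<longleftrightarrow>
     (\<lambda>q. fourier_norm (F q) (\<chi> q) d p (E q))
       \<lesssim> (\<lambda>q. real (card (E q)) powr (1 - s) / real q ^ d)"

end

theory Submission
  imports Defs "HOL-Analysis.Convex"
begin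

text \<open>
  By Cauchy--Schwarz, the square of the number \<open>N\<close> of tuples in \<open>E\<^sub>1 \<times> \<dots> \<times> E\<^sub>k\<close> is at most the size of
  the sumset times the number of pairs of tuples with equal sum. By Plancherel, the latter number
  is \<open>q\<^sup>-\<^sup>d\<close> times the sum over all frequencies of the product of the squared exponential sums of the
  \<open>E\<^sub>i\<close>. The zero frequency contributes \<open>N\<^sup>2\<close>; Hoelder's inequality with exponents \<open>p\<^sub>i\<close> and the Salem
  property bound the contribution of the others by a constant times
  \<open>q\<^sup>d N\<^sup>2\<close> divided by the product of the \<open>(#E\<^sub>i)\<close> to the power \<open>2 s\<^sub>i\<close>.
\<close>

section \<open>Hoelder's inequality for finitely many functions\<close>

text \<open>Jensen's inequality for the convex function \<open>exp\<close> at the points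
  \<open>ln (a i)\<close>. A vanishing \<open>a i\<close> has no logarithm to work with and is split
  off first.\<close>

lemma weighted_am_gm:
  fixes w a :: "'i \<Rightarrow> real"
  assumes "finite I" and w: "\<And>i. i \<in> I \<Longrightarrow> w i \<ge> 0" "(\<Sum>i\<in>I. w i) = 1"
    and a: "\<And>i. i \<in> I \<Longrightarrow> a i \<ge> 0"
  shows "(\<Prod>i\<in>I. a i powr w i) \<le> (\<Sum>i\<in>I. w i * a i)"
proof (cases "\<exists>i\<in>I. a i = 0")
  case True
  \<comment> \<open>This holds even if the weight at the zero factor is 0, since
    \<open>0 powr 0 = 0\<close>.\<close>
  then have "(\<Prod>i\<in>I. a i powr w i) = 0"
    using \<open>finite I\<close> by (intro prod_zero) auto
  then show ?thesis
    using w a by (simp add: sum_nonneg)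
next
  case False
  then have pos: "a i > 0" if "i \<in> I" for i
    using a[OF that] that by force
  have "I \<noteq> {}"
    using w by auto
  have "(\<Prod>i\<in>I. a i powr w i) = exp (\<Sum>i\<in>I. w i *\<^sub>R ln (a i))"
    using \<open>finite I\<close> pos by (force simp: exp_sum powr_def intro!: prod.cong)
  also have "\<dots> \<le> (\<Sum>i\<in>I. w i * exp (ln (a i)))"
    using \<open>finite I\<close> \<open>I \<noteq> {}\<close> w by (intro convex_on_sum[OF _ _ exp_convex]) auto
  also have "\<dots> = (\<Sum>i\<in>I. w i * a i)"
    using pos by (intro sum.cong) auto
  finally show ?thesis .
qed

text \<open>Divide each function by its norm, apply weighted AM-GM with weights
  \<open>1 / p i\<close> at every point and sum over \<open>X\<close>: the normalised function with
  index \<open>i\<close> then contributes exactly \<open>1 / p i\<close>. If some norm is 0, that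
  function vanishes on \<open>X\<close>, and so does the left-hand side.\<close>

lemma Holder_sum_prod:
  fixes a :: "'i \<Rightarrow> 'x \<Rightarrow> real" and p :: "'i \<Rightarrow> real"
  assumes "finite I" and "finite X"
    and p: "\<And>i. i \<in> I \<Longrightarrow> p i > 0" "(\<Sum>i\<in>I. 1 / p i) = 1"
    and a: "\<And>i x. i \<in> I \<Longrightarrow> x \<in> X \<Longrightarrow> a i x \<ge> 0"
  shows "(\<Sum>x\<in>X. \<Prod>i\<in>I. a i x) \<le> (\<Prod>i\<in>I. (\<Sum>x\<in>X. a i x powr p i) powr (1 / p i))"
proof (cases "\<exists>i\<in>I. (\<Sum>x\<in>X. a i x powr p i) = 0")
  case True
  then obtain i where i: "i \<in> I" "(\<Sum>x\<in>X. a i x powr p i) = 0"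
    by blast
  then have "a i x = 0" if "x \<in> X" for x
    using that \<open>finite X\<close> by (subst (asm) sum_nonneg_eq_0_iff) auto
  then have "(\<Sum>x\<in>X. \<Prod>i\<in>I. a i x) = 0"
    using \<open>finite I\<close> \<open>i \<in> I\<close> by (intro sum.neutral ballI prod_zero) auto
  then show ?thesis
    by (simp add: prod_nonneg)
next
  case False
  define M where "M i = (\<Sum>x\<in>X. a i x powr p i)" for i
  define N where "N = (\<Prod>i\<in>I. M i powr (1 / p i))"
  have M: "M i > 0" if "i \<in> I" for i
    using False that by (auto simp: M_def less_le sum_nonneg)
  then have "N > 0"
    by (auto simp: N_def intro!: prod_pos) (metis less_irrefl)
  have "(\<Prod>i\<in>I. a i x) / N \<le> (\<Sum>i\<in>I. 1 / p i * (a i x powr p i / M i))" if "x \<in> X" for x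
  proof -
    have "(\<Prod>i\<in>I. a i x) / N = (\<Prod>i\<in>I. (a i x powr p i / M i) powr (1 / p i))"
      unfolding N_def prod_dividef[symmetric]
    proof (rule prod.cong)
      fix i assume "i \<in> I"
      then show "a i x / M i powr (1 / p i) = (a i x powr p i / M i) powr (1 / p i)"
        using M[of i] a[of i x] p(1)[of i] that by (simp add: powr_divide powr_powr)
    qed simp
    also have "\<dots> \<le> (\<Sum>i\<in>I. 1 / p i * (a i x powr p i / M i))"
      using \<open>finite I\<close> p M by (intro weighted_am_gm) (auto intro: divide_nonneg_pos less_imp_le)
    finally show ?thesis .
  qed
  then have "(\<Sum>x\<in>X. (\<Prod>i\<in>I. a i x) / N) \<le> (\<Sum>x\<in>X. \<Sum>i\<in>I. 1 / p i * (a i x powr p i / M i))"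
    by (rule sum_mono)
  also have "\<dots> = (\<Sum>i\<in>I. 1 / p i * (M i / M i))"
    by (subst sum.swap) (simp only: M_def[symmetric] flip: sum_distrib_left sum_divide_distrib)
  also have "\<dots> = (\<Sum>i\<in>I. 1 / p i)"
    using M by (intro sum.cong) force+
  finally have "(\<Sum>x\<in>X. \<Prod>i\<in>I. a i x) / N \<le> 1"
    using p by (simp flip: sum_divide_distrib)
  then show ?thesis
    using \<open>N > 0\<close> by (simp add: N_def M_def)
qed

section \<open>Counting collisions of a map\<close>

text \<open>The fibre sizes \<open>r y\<close> sum to the size of \<open>T\<close>, and their
  squares sum to the number of collisions, so Cauchy-Schwarz over the image gives the bound.\<close>

lemma card_sq_le_card_image_mult_collisions:
  assumes "finite T"
  shows "(card T)\<^sup>2 \<le> card (f ` T) * card {(t, u). t \<in> T \<and> u \<in> T \<and> f t = f u}"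
proof -
  define r where "r y = card {t \<in> T. f t = y}" for y
  have T: "card T = (\<Sum>y\<in>f ` T. r y)"
    using sum.image_gen[OF assms, of "\<lambda>_. 1::nat" f] by (simp add: r_def)
  have "{(t, u). t \<in> T \<and> u \<in> T \<and> f t = f u} = (SIGMA t:T. {u \<in> T. f u = f t})"
    by auto
  then have "card {(t, u). t \<in> T \<and> u \<in> T \<and> f t = f u} = (\<Sum>t\<in>T. r (f t))"
    using assms by (simp add: r_def)
  also have "\<dots> = (\<Sum>y\<in>f ` T. \<Sum>t\<in>{t \<in> T. f t = y}. r (f t))"
    by (rule sum.image_gen[OF assms])
  also have "\<dots> = (\<Sum>y\<in>f ` T. (r y)\<^sup>2)"
    by (intro sum.cong) (auto simp: r_def power2_eq_square)
  finally have C: "card {(t, u). t \<in> T \<and> u \<in> T \<and> f t = f u} = (\<Sum>y\<in>f ` T. (r y)\<^sup>2)" .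
  have "(\<Sum>y\<in>f ` T. real (r y))\<^sup>2 \<le> (\<Sum>y\<in>f ` T. (real (r y))\<^sup>2) * card (f ` T)"
    by (rule sum_squared_le_sum_of_squares)
  then have "real ((card T)\<^sup>2) \<le>
      real (card (f ` T) * card {(t, u). t \<in> T \<and> u \<in> T \<and> f t = f u})"
    unfolding C unfolding T by (simp add: mult.commute)
  then show ?thesis
    by (simp only: of_nat_le_iff)
qed

section \<open>Additive characters over one fixed finite field, and their orthogonality\<close>

locale finite_field_char = field R for R :: "('a, 'm) ring_scheme" (structure) +
  fixes \<chi> :: "'a \<Rightarrow> complex"
  assumes finite_carrier: "finite (carrier R)"
    and nontrivial_char: "nontrivial_add_char R \<chi>"
begin

lemma norm_char: "a \<in> carrier R \<Longrightarrow> cmod (\<chi> a) = 1"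
  and char_add: "a \<in> carrier R \<Longrightarrow> b \<in> carrier R \<Longrightarrow> \<chi> (a \<oplus> b) = \<chi> a * \<chi> b"
  using nontrivial_char by (auto simp: nontrivial_add_char_def)

lemma char_zero: "\<chi> \<zero> = 1"
  using char_add[of \<zero> \<zero>] norm_char[of \<zero>] by auto

lemma char_minus: "a \<in> carrier R \<Longrightarrow> \<chi> (\<ominus> a) = cnj (\<chi> a)"
proof -
  assume a: "a \<in> carrier R"
  have "\<chi> a * \<chi> (\<ominus> a) = \<chi> a * cnj (\<chi> a)"
    using a char_add[of a "\<ominus> a"] norm_char[of a]
    by (simp add: r_neg char_zero complex_norm_square[symmetric])
  moreover have "\<chi> a \<noteq> 0"
    using norm_char[OF a] by auto
  ultimately show ?thesis
    by simp
qed

lemma char_finsum: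
  "finite A \<Longrightarrow> f \<in> A \<rightarrow> carrier R \<Longrightarrow> \<chi> (\<Oplus>i\<in>A. f i) = (\<Prod>i\<in>A. \<chi> (f i))"
  by (induction A rule: finite_induct) (auto simp: char_zero char_add Pi_def)

text \<open>Translating the summation variable by \<open>e\<close> permutes the field and multiplies
  the sum by \<open>\<chi> (e \<otimes> b)\<close>. Division by \<open>b\<close> allows this factor
  to be any character value, in particular one different from 1, so the sum must be 0.\<close>

lemma sum_char_mult:
  assumes b: "b \<in> carrier R" "b \<noteq> \<zero>"
  shows "(\<Sum>a\<in>carrier R. \<chi> (a \<otimes> b)) = 0"
proof -
  obtain c where c: "c \<in> carrier R" "\<chi> c \<noteq> 1"
    using nontrivial_char by (auto simp: nontrivial_add_char_def)
  define e where "e = c \<otimes> inv b"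
  have inv_b: "inv b \<in> carrier R" "inv b \<otimes> b = \<one>"
    using b field_Units by auto
  then have e: "e \<in> carrier R" "e \<otimes> b = c"
    using b c by (auto simp: e_def m_assoc)
  have "bij_betw (\<lambda>a. a \<oplus> e) (carrier R) (carrier R)"
    using e by (intro bij_betwI[where g = "\<lambda>a. a \<ominus> e"]) (auto simp: minus_eq a_assoc r_neg l_neg)
  then have "(\<Sum>a\<in>carrier R. \<chi> (a \<otimes> b)) = (\<Sum>a\<in>carrier R. \<chi> ((a \<oplus> e) \<otimes> b))"
    by (rule sum.reindex_bij_betw[symmetric])
  also have "\<dots> = (\<Sum>a\<in>carrier R. \<chi> (a \<otimes> b) * \<chi> c)"
    using b e by (intro sum.cong) (auto simp: l_distr char_add)
  finally have "(\<Sum>a\<in>carrier R. \<chi> (a \<otimes> b)) * (1 - \<chi> c) = 0"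
    unfolding sum_distrib_right[symmetric] right_diff_distrib by simp
  then show ?thesis
    using c by simp
qed

lemma vecs_nth: "x \<in> vecs R d \<Longrightarrow> i < d \<Longrightarrow> x i \<in> carrier R"
  by (simp add: vecs_def PiE_iff)

lemma dot_closed: "x \<in> vecs R d \<Longrightarrow> y \<in> vecs R d \<Longrightarrow> dot R d x y \<in> carrier R"
  by (auto simp: dot_def vecs_nth)

text \<open>Splitting the character into coordinates is what lets sums over all vectors factor into
  sums over the field.\<close>

lemma char_minus_dot:
  assumes "x \<in> vecs R d" "y \<in> vecs R d"
  shows "\<chi> (\<ominus> dot R d x y) = (\<Prod>i<d. cnj (\<chi> (x i \<otimes> y i)))"
  using assms unfolding char_minus[OF dot_closed[OF assms]] unfolding dot_def
  by (subst char_finsum) (auto simp: vecs_nth)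

lemma finite_vecs: "finite (vecs R d)"
  using finite_carrier by (auto simp: vecs_def intro: finite_PiE)

lemma zero_vec_in_vecs: "zero_vec R d \<in> vecs R d"
  by (auto simp: zero_vec_def vecs_def)

lemma char_minus_dot_zero:
  assumes "y \<in> vecs R d"
  shows "\<chi> (\<ominus> dot R d (zero_vec R d) y) = 1"
proof -
  have "\<zero> \<otimes> y i = \<zero>" if "i < d" for i
    using vecs_nth[OF assms that] by simp
  then show ?thesis
    using assms unfolding char_minus_dot[OF zero_vec_in_vecs assms]
    by (simp add: zero_vec_def char_zero)
qed

text \<open>The sum factors over the coordinates. The factor at \<open>i\<close> is a complete
  character sum with multiplier \<open>z i \<ominus> y i\<close>: it is the field size if the
  multiplier is zero, and vanishes otherwise.\<close>

lemma char_orthogonality: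
  assumes y: "y \<in> vecs R d" and z: "z \<in> vecs R d"
  shows "(\<Sum>x\<in>vecs R d. \<chi> (\<ominus> dot R d x y) * cnj (\<chi> (\<ominus> dot R d x z))) =
    (if y = z then of_nat (card (carrier R)) ^ d else 0)"
proof -
  have yz: "y i \<in> carrier R" "z i \<in> carrier R" if "i < d" for i
    using that y z vecs_nth by blast+
  have "(\<Sum>x\<in>vecs R d. \<chi> (\<ominus> dot R d x y) * cnj (\<chi> (\<ominus> dot R d x z))) =
      (\<Sum>x\<in>vecs R d. \<Prod>i<d. \<chi> (x i \<otimes> (z i \<ominus> y i)))"
  proof (rule sum.cong)
    fix x assume x: "x \<in> vecs R d"
    have "cnj (\<chi> (x i \<otimes> y i)) * \<chi> (x i \<otimes> z i) = \<chi> (x i \<otimes> (z i \<ominus> y i))" if "i < d" for i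
      using yz[OF that] x that
      by (simp add: vecs_nth minus_eq r_distr r_minus char_add char_minus)
    then show "\<chi> (\<ominus> dot R d x y) * cnj (\<chi> (\<ominus> dot R d x z)) = (\<Prod>i<d. \<chi> (x i \<otimes> (z i \<ominus> y i)))"
      using x y z by (simp add: char_minus_dot flip: prod.distrib)
  qed simp
  also have "\<dots> = (\<Prod>i<d. \<Sum>a\<in>carrier R. \<chi> (a \<otimes> (z i \<ominus> y i)))"
    unfolding vecs_def using finite_carrier by (intro prod_sum_PiE[symmetric]) auto
  also have "\<dots> = (if y = z then of_nat (card (carrier R)) ^ d else 0)"
  proof (cases "y = z")
    case True
    have "(\<Sum>a\<in>carrier R. \<chi> (a \<otimes> (z i \<ominus> y i))) = of_nat (card (carrier R))" if "i < d" for i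
      using True yz[OF that] by (simp add: minus_eq r_neg char_zero)
    then show ?thesis
      using True by simp
  next
    case False
    \<comment> \<open>Extensionality forces distinct vectors to differ at an index below
      \<open>d\<close>.\<close>
    then obtain i where "i < d" "z i \<noteq> y i"
      using PiE_ext[of y "{..<d}" "\<lambda>_. carrier R" z] y z by (force simp: vecs_def)
    then have "(\<Sum>a\<in>carrier R. \<chi> (a \<otimes> (z i \<ominus> y i))) = 0"
      using yz[of i] minus_equality[of "z i" "\<ominus> y i"] by (intro sum_char_mult) (auto simp: minus_eq)
    then show ?thesis
      using False \<open>i < d\<close> by (auto intro!: prod_zero)
  qed
  finally show ?thesis .
qed

text \<open>Expand each square into a sum over pairs and sum over the frequency first; orthogonality
  keeps exactly the colliding pairs.\<close>

lemma Plancherel_collisions: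
  assumes "finite T" and f: "\<And>t. t \<in> T \<Longrightarrow> f t \<in> vecs R d"
  shows "(\<Sum>x\<in>vecs R d. (cmod (\<Sum>t\<in>T. \<chi> (\<ominus> dot R d x (f t))))\<^sup>2) =
    real (card (carrier R)) ^ d * card {(t, u). t \<in> T \<and> u \<in> T \<and> f t = f u}"
proof -
  have "complex_of_real (\<Sum>x\<in>vecs R d. (cmod (\<Sum>t\<in>T. \<chi> (\<ominus> dot R d x (f t))))\<^sup>2) =
      (\<Sum>x\<in>vecs R d. \<Sum>(t, u)\<in>T \<times> T. \<chi> (\<ominus> dot R d x (f t)) * cnj (\<chi> (\<ominus> dot R d x (f u))))"
    by (simp add: complex_norm_square sum_product sum.cartesian_product del: of_real_power)
  also have "\<dots> = (\<Sum>(t, u)\<in>T \<times> T. if f t = f u then of_nat (card (carrier R)) ^ d else 0)"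
    using f by (subst sum.swap) (auto intro!: sum.cong simp: char_orthogonality)
  also have "\<dots> = (\<Sum>(t, u)\<in>{(t, u). t \<in> T \<and> u \<in> T \<and> f t = f u}. of_nat (card (carrier R)) ^ d)"
    using \<open>finite T\<close> by (intro sum.mono_neutral_cong_right) (auto split: if_splits)
  also have "\<dots> = complex_of_real (real (card (carrier R)) ^ d *
      card {(t, u). t \<in> T \<and> u \<in> T \<and> f t = f u})"
    by (simp add: case_prod_unfold)
  finally show ?thesis
    by (simp only: of_real_eq_iff)
qed

section \<open>From sumsets to moments of exponential sums\<close>

text \<open>Collision counting and Plancherel are applied to the map sending a tuple to its sum. The
  exponential sum over all tuples is the product of those over the sets \<open>A j\<close>.\<close>

lemma card_sumset_lower_bound:
  assumes A: "\<And>j. j \<in> {1..k} \<Longrightarrow> A j \<subseteq> vecs R d"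
  shows "real (card (carrier R)) ^ d * (\<Prod>j=1..k. real (card (A j)))\<^sup>2 \<le>
    card (sumset R d k A) *
      (\<Sum>x\<in>vecs R d. \<Prod>j=1..k. (cmod (\<Sum>y\<in>A j. \<chi> (\<ominus> dot R d x y)))\<^sup>2)"
proof -
  define T where "T = PiE {1..k} A"
  define f where "f t = (\<lambda>i\<in>{..<d}. \<Oplus>j\<in>{1..k}. t j i)" for t :: "nat \<Rightarrow> nat \<Rightarrow> 'a"
  have finA: "finite (A j)" if "j \<in> {1..k}" for j
    using A[OF that] finite_vecs finite_subset by blast
  then have finT: "finite T"
    by (auto simp: T_def intro: finite_PiE)
  have tA: "t j \<in> vecs R d" if "t \<in> T" "j \<in> {1..k}" for t j
    using that A[of j] PiE_mem[of t "{1..k}" A j] by (auto simp: T_def)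
  then have tj: "t j i \<in> carrier R" if "t \<in> T" "j \<in> {1..k}" "i < d" for t j i
    using that vecs_nth by blast
  have fT: "f t \<in> vecs R d" if "t \<in> T" for t
    using tj[OF that] by (auto simp: f_def vecs_def intro!: finsum_closed)
  have image: "sumset R d k A = f ` T"
  proof
    show "sumset R d k A \<subseteq> f ` T"
    proof
      fix y assume "y \<in> sumset R d k A"
      then obtain x where x: "y = f x" "\<forall>j\<in>{1..k}. x j \<in> A j"
        by (auto simp: sumset_def f_def)
      \<comment> \<open>\<open>sumset\<close> ranges over arbitrary functions \<open>x\<close>, but
        \<open>T\<close> holds only extensional ones; values outside \<open>{1..k}\<close> do not
        affect the sum.\<close>
      have "f x = f (restrict x {1..k})"
        unfolding f_def using x(2) A
        by (intro restrict_ext finsum_cong') (fastforce simp: vecs_def)+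
      moreover have "restrict x {1..k} \<in> T"
        using x(2) by (auto simp: T_def)
      ultimately show "y \<in> f ` T"
        using x(1) by blast
    qed
    show "f ` T \<subseteq> sumset R d k A"
      by (fastforce simp: sumset_def f_def T_def)
  qed
  have char_f: "\<chi> (\<ominus> dot R d x (f t)) = (\<Prod>j=1..k. \<chi> (\<ominus> dot R d x (t j)))"
    if x: "x \<in> vecs R d" and t: "t \<in> T" for x t
  proof -
    have "\<chi> (x i \<otimes> f t i) = (\<Prod>j=1..k. \<chi> (x i \<otimes> t j i))" if "i < d" for i
    proof -
      have xi: "x i \<in> carrier R"
        using x that by (rule vecs_nth)
      have "x i \<otimes> f t i = (\<Oplus>j\<in>{1..k}. x i \<otimes> t j i)"
        using tj[OF t] xi that unfolding f_def by (simp add: finsum_rdistr Pi_def)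
      then show ?thesis
        using tj[OF t] xi that by (simp add: char_finsum Pi_def)
    qed
    then have "\<chi> (\<ominus> dot R d x (f t)) = (\<Prod>i<d. \<Prod>j=1..k. cnj (\<chi> (x i \<otimes> t j i)))"
      using x fT[OF t] by (simp add: char_minus_dot)
    also have "\<dots> = (\<Prod>j=1..k. \<chi> (\<ominus> dot R d x (t j)))"
      using x tA[OF t] by (subst prod.swap) (simp add: char_minus_dot)
    finally show ?thesis .
  qed
  have "(cmod (\<Sum>t\<in>T. \<chi> (\<ominus> dot R d x (f t))))\<^sup>2 =
      (\<Prod>j=1..k. (cmod (\<Sum>y\<in>A j. \<chi> (\<ominus> dot R d x y)))\<^sup>2)" if "x \<in> vecs R d" for x
  proof -
    \<comment> \<open>Expanding the product of sums yields one term for each tuple in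
      \<open>T\<close>.\<close>
    have "(\<Sum>t\<in>T. \<chi> (\<ominus> dot R d x (f t))) = (\<Prod>j=1..k. \<Sum>y\<in>A j. \<chi> (\<ominus> dot R d x y))"
      using finA that by (subst prod_sum_PiE) (auto simp: char_f T_def)
    then show ?thesis
      by (simp add: prod_power_distrib flip: prod_norm)
  qed
  then have "(\<Sum>x\<in>vecs R d. \<Prod>j=1..k. (cmod (\<Sum>y\<in>A j. \<chi> (\<ominus> dot R d x y)))\<^sup>2) =
      real (card (carrier R)) ^ d * card {(t, u). t \<in> T \<and> u \<in> T \<and> f t = f u}"
    using Plancherel_collisions[of T f d] finT fT by simp
  moreover have "real ((card T)\<^sup>2) \<le>
      real (card (f ` T) * card {(t, u). t \<in> T \<and> u \<in> T \<and> f t = f u})"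
    unfolding of_nat_le_iff by (rule card_sq_le_card_image_mult_collisions[OF finT])
  then have "real (card (carrier R)) ^ d * (real (card T))\<^sup>2 \<le> real (card (carrier R)) ^ d *
      (card (f ` T) * card {(t, u). t \<in> T \<and> u \<in> T \<and> f t = f u})"
    by (intro mult_left_mono) auto
  moreover have "real (card T) = (\<Prod>j=1..k. real (card (A j)))"
    by (simp add: T_def card_PiE)
  ultimately show ?thesis
    unfolding image by (simp add: mult_ac)
qed

section \<open>The Salem property and the bound for a single field\<close>

text \<open>This translates a factor from Hoelder's inequality into \<open>fourier_norm\<close>.
  Undoing the normalisation of the transform gives the field size to the power \<open>d\<close>
  inside the square; undoing the average over frequencies gives the factor with exponent
  \<open>1 / p\<close>.\<close>

lemma sum_nonzero_char_powr:
  assumes "p > 0"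
  shows "(\<Sum>x\<in>vecs R d - {zero_vec R d}.
      (cmod (\<Sum>y\<in>A. \<chi> (\<ominus> dot R d x y)))\<^sup>2 powr p) powr (1 / p) =
    (real (card (carrier R)) ^ d) powr (1 / p) *
      (real (card (carrier R)) ^ d * fourier_norm R \<chi> d (2 * p) A)\<^sup>2"
proof -
  define Q where "Q = real (card (carrier R)) ^ d"
  define S where "S = (\<Sum>x\<in>vecs R d - {zero_vec R d}. cmod (fourier R \<chi> d A x) powr (2 * p))"
  have "card (carrier R) > 0"
    using finite_carrier by (auto simp: card_gt_0_iff)
  then have Q: "Q > 0"
    by (simp add: Q_def)
  have S: "S \<ge> 0"
    by (simp add: S_def sum_nonneg)
  have "(cmod (\<Sum>y\<in>A. \<chi> (\<ominus> dot R d x y)))\<^sup>2 powr p =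
      Q powr (2 * p) * cmod (fourier R \<chi> d A x) powr (2 * p)" for x
  proof -
    have "cmod (\<Sum>y\<in>A. \<chi> (\<ominus> dot R d x y)) = Q * cmod (fourier R \<chi> d A x)"
      using Q by (simp add: fourier_def Q_def norm_divide norm_power)
    moreover have "u\<^sup>2 powr p = u powr (2 * p)" if "u \<ge> 0" for u :: real
      using that by (cases "u = 0") (simp_all add: powr_powr flip: powr_numeral)
    ultimately show ?thesis
      using Q by (simp add: powr_mult)
  qed
  then have "(\<Sum>x\<in>vecs R d - {zero_vec R d}.
      (cmod (\<Sum>y\<in>A. \<chi> (\<ominus> dot R d x y)))\<^sup>2 powr p) powr (1 / p) = (Q powr (2 * p) * S) powr (1 / p)"
    by (simp add: S_def flip: sum_distrib_left)
  also have "\<dots> = Q\<^sup>2 * S powr (1 / p)"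
    using Q S assms by (simp add: powr_mult powr_powr)
  also have "S powr (1 / p) = Q powr (1 / p) * (S / Q) powr (1 / p)"
    using Q S by (simp add: powr_divide)
  \<comment> \<open>The norm is the root of order \<open>2 * p\<close>, so its square is the root of
    order \<open>p\<close>.\<close>
  also have "(S / Q) powr (1 / p) = (fourier_norm R \<chi> d (2 * p) A)\<^sup>2"
    using Q S assms by (simp add: fourier_norm_def S_def[symmetric] Q_def[symmetric] power2_eq_square
        flip: powr_add)
  finally show ?thesis
    by (simp add: Q_def power_mult_distrib mult_ac)
qed

text \<open>The constant is explicit and involves only the \<open>c j\<close>, so it is uniform in
  the field whenever the \<open>c j\<close> are.\<close>

lemma card_sumset_salem_bound:
  assumes A: "\<And>j. j \<in> {1..k} \<Longrightarrow> A j \<subseteq> vecs R d \<and> A j \<noteq> {}"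
    and p: "\<And>j. j \<in> {1..k} \<Longrightarrow> p j > 0" "(\<Sum>j=1..k. 1 / p j) = 1"
    and c: "\<And>j. j \<in> {1..k} \<Longrightarrow> fourier_norm R \<chi> d (2 * p j) (A j) \<le>
      c j * (real (card (A j)) powr (1 - s j) / real (card (carrier R)) ^ d)"
  shows "min (real (card (carrier R)) ^ d) (\<Prod>j=1..k. real (card (A j)) powr (2 * s j)) \<le>
    (1 + (\<Prod>j=1..k. (c j)\<^sup>2)) * card (sumset R d k A)"
proof -
  define Q where "Q = real (card (carrier R)) ^ d"
  define N where "N = (\<Prod>j=1..k. real (card (A j)))"
  define P where "P = (\<Prod>j=1..k. real (card (A j)) powr (2 * s j))"
  define C where "C = (\<Prod>j=1..k. (c j)\<^sup>2)"
  define S where "S j x = (cmod (\<Sum>y\<in>A j. \<chi> (\<ominus> dot R d x y)))\<^sup>2" for j x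
  have "card (carrier R) > 0"
    using finite_carrier by (auto simp: card_gt_0_iff)
  then have Q: "Q > 0"
    by (simp add: Q_def)
  have cardA: "real (card (A j)) > 0" if "j \<in> {1..k}" for j
    using A[OF that] finite_vecs[of d] by (auto simp: card_gt_0_iff intro: finite_subset)
  then have N: "N > 0" and P: "P > 0"
    unfolding N_def P_def by (force intro!: prod_pos)+
  have C: "C \<ge> 0"
    by (simp add: C_def prod_nonneg)
  have S0: "(\<Prod>j=1..k. S j (zero_vec R d)) = N\<^sup>2"
  proof -
    have "S j (zero_vec R d) = (real (card (A j)))\<^sup>2" if "j \<in> {1..k}" for j
    proof -
      have "(\<Sum>y\<in>A j. \<chi> (\<ominus> dot R d (zero_vec R d) y)) = (\<Sum>y\<in>A j. 1)"
        using A[OF that] by (intro sum.cong char_minus_dot_zero) auto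
      then show ?thesis
        by (simp add: S_def)
    qed
    then show ?thesis
      by (simp add: N_def prod_power_distrib)
  qed
  \<comment> \<open>Hoelder is applied only off the zero frequency, where the Salem hypothesis gives
    information.\<close>
  have "(\<Sum>x\<in>vecs R d - {zero_vec R d}. \<Prod>j=1..k. S j x) \<le>
      (\<Prod>j=1..k. (\<Sum>x\<in>vecs R d - {zero_vec R d}. S j x powr p j) powr (1 / p j))"
    using p finite_vecs by (intro Holder_sum_prod) (auto simp: S_def)
  also have "\<dots> = (\<Prod>j=1..k. Q powr (1 / p j) * (Q * fourier_norm R \<chi> d (2 * p j) (A j))\<^sup>2)"
    unfolding S_def Q_def using p by (intro prod.cong sum_nonzero_char_powr) auto
  also have "\<dots> \<le> (\<Prod>j=1..k. Q powr (1 / p j) *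
      ((c j)\<^sup>2 * ((real (card (A j)))\<^sup>2 / real (card (A j)) powr (2 * s j))))"
  proof (intro prod_mono conjI mult_left_mono)
    fix j assume j: "j \<in> {1..k}"
    have "Q * fourier_norm R \<chi> d (2 * p j) (A j) \<le> c j * real (card (A j)) powr (1 - s j)"
      using c[OF j] Q by (simp add: field_simps flip: Q_def)
    moreover have "0 \<le> Q * fourier_norm R \<chi> d (2 * p j) (A j)"
      using Q by (simp add: fourier_norm_def)
    ultimately have "(Q * fourier_norm R \<chi> d (2 * p j) (A j))\<^sup>2 \<le>
        (c j * real (card (A j)) powr (1 - s j))\<^sup>2"
      by (rule power_mono)
    also have "\<dots> = (c j)\<^sup>2 * real (card (A j)) powr (2 - 2 * s j)"
      by (simp add: power_mult_distrib power2_eq_square flip: powr_add)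
    also have "real (card (A j)) powr (2 - 2 * s j) =
        (real (card (A j)))\<^sup>2 / real (card (A j)) powr (2 * s j)"
      using cardA[OF j] by (simp add: powr_diff)
    finally show "(Q * fourier_norm R \<chi> d (2 * p j) (A j))\<^sup>2 \<le>
        (c j)\<^sup>2 * ((real (card (A j)))\<^sup>2 / real (card (A j)) powr (2 * s j))" .
  qed auto
  \<comment> \<open>The averaging factors \<open>Q powr (1 / p j)\<close> multiply to a single
    \<open>Q\<close>, because the reciprocals of the exponents sum to 1.\<close>
  also have "\<dots> = Q powr (\<Sum>j=1..k. 1 / p j) * (C * (N\<^sup>2 / P))"
    using Q by (simp add: C_def N_def P_def prod.distrib prod_dividef powr_sum flip: prod_power_distrib)
  also have "\<dots> = Q * (C * (N\<^sup>2 / P))"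
    using Q p by simp
  finally have rest: "(\<Sum>x\<in>vecs R d - {zero_vec R d}. \<Prod>j=1..k. S j x) \<le> Q * (C * (N\<^sup>2 / P))" .
  have "Q * N\<^sup>2 \<le> card (sumset R d k A) * (\<Sum>x\<in>vecs R d. \<Prod>j=1..k. S j x)"
    unfolding Q_def N_def S_def using A by (intro card_sumset_lower_bound) auto
  also have "\<dots> \<le> card (sumset R d k A) * (N\<^sup>2 + Q * (C * (N\<^sup>2 / P)))"
    using rest S0 finite_vecs zero_vec_in_vecs
    by (intro mult_left_mono) (simp_all add: sum.remove[of _ "zero_vec R d"])
  \<comment> \<open>Multiplying by \<open>P\<close> clears the denominator; the common positive
    factor \<open>N\<^sup>2\<close> then cancels.\<close>
  finally have "Q * P * N\<^sup>2 \<le> card (sumset R d k A) * (P + Q * C) * N\<^sup>2"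
    using P by (simp add: field_simps)
  then have main: "Q * P \<le> card (sumset R d k A) * (P + Q * C)"
    by (rule mult_right_le_imp_le) (use N in simp)
  \<comment> \<open>The minimum is bounded by \<open>Q\<close> against the zero-frequency term
    \<open>P\<close> and by \<open>P\<close> against the term \<open>Q * C\<close>, so both become
    multiples of \<open>Q * P\<close>.\<close>
  have "min Q P * (P + Q * C) \<le> Q * P + P * (Q * C)"
    unfolding distrib_left using P Q C by (intro add_mono mult_right_mono) auto
  also have "\<dots> = (1 + C) * (Q * P)"
    by (simp add: algebra_simps)
  also have "\<dots> \<le> (1 + C) * (card (sumset R d k A) * (P + Q * C))"
    using main C by (intro mult_left_mono) auto
  finally have "min Q P * (P + Q * C) \<le> ((1 + C) * card (sumset R d k A)) * (P + Q * C)"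
    by (simp add: mult.assoc)
  moreover have "P + Q * C > 0"
    using P Q C by (intro add_pos_nonneg) auto
  ultimately have "min Q P \<le> (1 + C) * card (sumset R d k A)"
    by (rule mult_right_le_imp_le)
  then show ?thesis
    by (simp only: Q_def P_def C_def)
qed

end

section \<open>Uniformity in the field size\<close>

theorem theorem6p1:
  fixes F :: "nat \<Rightarrow> ('a, 'm) ring_scheme"
    and \<chi> :: "nat \<Rightarrow> 'a \<Rightarrow> complex"
    and d k :: nat
    and E :: "nat \<Rightarrow> nat \<Rightarrow> (nat \<Rightarrow> 'a) set"
    and p s :: "nat \<Rightarrow> real"
  assumes "finite_field_family F"
    and "\<And>q. primepow q \<Longrightarrow> nontrivial_add_char (F q) (\<chi> q)"
    and "\<And>i q. i \<in> {1..k} \<Longrightarrow> primepow q \<Longrightarrow> E i q \<subseteq> vecs (F q) d \<and> E i q \<noteq> {}"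
    and "\<And>i. i \<in> {1..k} \<Longrightarrow> p i \<ge> 1"
    and "(\<Sum>i=1..k. 1 / p i) = 1"
    and "\<And>i. i \<in> {1..k} \<Longrightarrow> salem F \<chi> d (2 * p i) (s i) (E i)"
  shows "(\<lambda>q. real (card (sumset (F q) d k (\<lambda>i. E i q))))
           \<greatersim> (\<lambda>q. min (real q ^ d) (\<Prod>i=1..k. real (card (E i q)) powr (2 * s i)))"
proof -
  \<comment> \<open>The Salem constants are chosen before \<open>q\<close>, so the final constant
    built from them does not depend on \<open>q\<close>.\<close>
  have "\<forall>i\<in>{1..k}. \<exists>c. \<forall>q. primepow q \<longrightarrow> fourier_norm (F q) (\<chi> q) d (2 * p i) (E i q) \<le>
      c * (real (card (E i q)) powr (1 - s i) / real q ^ d)"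
    using assms(6) unfolding salem_def lesssim_def by blast
  then obtain c where c: "\<And>i q. i \<in> {1..k} \<Longrightarrow> primepow q \<Longrightarrow>
      fourier_norm (F q) (\<chi> q) d (2 * p i) (E i q) \<le>
        c i * (real (card (E i q)) powr (1 - s i) / real q ^ d)"
    by (metis (no_types, lifting))
  show ?thesis
    unfolding lesssim_def
  proof (intro exI conjI allI impI)
    show "1 + (\<Prod>i=1..k. (c i)\<^sup>2) > 0"
      by (intro add_pos_nonneg prod_nonneg) auto
  next
    fix q :: nat assume q: "primepow q"
    then have field: "field (F q)" "finite (carrier (F q))" and card: "card (carrier (F q)) = q"
      using assms(1) by (auto simp: finite_field_family_def)
    interpret finite_field_char "F q" "\<chi> q"
      using field assms(2)[OF q]
      by (intro finite_field_char.intro finite_field_char_axioms.intro)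
    have "p i > 0" if "i \<in> {1..k}" for i
      using assms(4)[OF that] by simp
    then show "min (real q ^ d) (\<Prod>i=1..k. real (card (E i q)) powr (2 * s i)) \<le>
        (1 + (\<Prod>i=1..k. (c i)\<^sup>2)) * real (card (sumset (F q) d k (\<lambda>i. E i q)))"
      using card_sumset_salem_bound[of k "\<lambda>i. E i q" d p c s] assms(3)[OF _ q] assms(5) c[OF _ q]
      unfolding card by blast
  qed
qed

end
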